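(* Let $\mathbb F$ be an arbitrary field and let $W$ be an $n$-dimensional vector space over $\mathbb F$. Let $U_1,\ldots,U_m$ and $V_1,\ldots,V_m$ be subspaces of $W$, and let $t$ be an integer with $0\le t\le n$, such that (i) $\dim(U_i\cap V_i)\le t$ for each $1\le i\le m$; (ii) $\dim(U_i\cap V_j)>t$ whenever $1\le i<j\le m$. Then $m\le 2^{n-t}$. *)

theory Defs imports Complex_Main begin

end

theory Submission imports Defs "HOL-Computational_Algebra.Polynomial" begin

text \<open>Put \<open>r = n - t\<close> and pass to orthogonal complements \<open>X\<^sub>i\<close>, \<open>Y\<^sub>i\<close> of \<open>U\<^sub>i\<close>, \<open>V\<^sub>i\<close> with respect to
  a coordinate form: the hypotheses become \<open>dim (X\<^sub>i + Y\<^sub>i) \<ge> r\<close> and \<open>dim (X\<^sub>i + Y\<^sub>j) < r\<close> for \<open>i < j\<close>.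
  A generic linear map \<open>\<phi>\<close> from \<open>F\<^sup>n\<close> to \<open>F[x]\<^sup>r\<close> has the property that \<open>det (\<phi> w\<^sub>1, \<dots>, \<phi> w\<^sub>r)\<close> vanishes
  exactly when \<open>w\<^sub>1, \<dots>, w\<^sub>r\<close> are dependent over \<open>F\<close>; using polynomials avoids any assumption on the
  size of \<open>F\<close>. Choose \<open>r\<close> independent vectors in \<open>X\<^sub>i \<union> Y\<^sub>i\<close>, a list \<open>a\<^sub>i\<close> from \<open>X\<^sub>i\<close> followed by a list
  \<open>b\<^sub>i\<close> from \<open>Y\<^sub>i\<close>. The matrix of the values \<open>det (\<phi> a\<^sub>i, \<phi> b\<^sub>j)\<close> is triangular with nonzero diagonal,
  and by Laplace expansion along the rows of \<open>a\<^sub>i\<close> it has rank at most \<open>2\<^sup>r\<close>.\<close>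

section \<open>Determinants of lists of vectors\<close>

definition remove_nth :: "nat \<Rightarrow> 'a list \<Rightarrow> 'a list" where
  "remove_nth i xs = take i xs @ drop (Suc i) xs"

lemma remove_nth_Cons [simp]:
  "remove_nth 0 (x # xs) = xs"
  "remove_nth (Suc i) (x # xs) = x # remove_nth i xs"
  by (simp_all add: remove_nth_def)

lemma remove_nth_append:
  "i < length xs \<Longrightarrow> remove_nth i (xs @ ys) = remove_nth i xs @ ys"
  "remove_nth (length xs + i) (xs @ ys) = xs @ remove_nth i ys"
  by (simp_all add: remove_nth_def)

lemma length_remove_nth: "i < length xs \<Longrightarrow> length (remove_nth i xs) = length xs - 1"
  by (simp add: remove_nth_def)

lemma sum_lessThan_add:
  "(\<Sum>i<a + b. f i) = (\<Sum>i<a. f i) + (\<Sum>i<b. f (a + i))"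
  for f :: "nat \<Rightarrow> 'a::comm_monoid_add"
  by (induction b) (simp_all add: add_ac)

text \<open>The determinant of the matrix with entries \<open>\<phi> k (vs ! i)\<close>, \<open>k < r\<close>, expanded along the
  last column; it is \<open>0\<close> unless \<open>vs\<close> has length \<open>r\<close>.\<close>

fun list_det :: "(nat \<Rightarrow> 'w \<Rightarrow> 'r::comm_ring_1) \<Rightarrow> nat \<Rightarrow> 'w list \<Rightarrow> 'r" where
  "list_det \<phi> 0 vs = (if vs = [] then 1 else 0)"
| "list_det \<phi> (Suc r) vs =
     (\<Sum>i<length vs. (- 1) ^ i * \<phi> r (vs ! i) * list_det \<phi> r (remove_nth i vs))"

lemma list_det_wrong_length: "length vs \<noteq> r \<Longrightarrow> list_det \<phi> r vs = 0"
proof (induction r arbitrary: vs)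
  case (Suc r)
  have "list_det \<phi> r (remove_nth i vs) = 0" if "i < length vs" for i
    using Suc.prems that by (intro Suc.IH) (simp add: length_remove_nth)
  then show ?case by simp
qed auto

lemma list_det_append:
  "list_det \<phi> (Suc r) (xs @ ys) =
     (\<Sum>i<length xs. (- 1) ^ i * \<phi> r (xs ! i) * list_det \<phi> r (remove_nth i xs @ ys)) +
     (- 1) ^ length xs *
     (\<Sum>i<length ys. (- 1) ^ i * \<phi> r (ys ! i) * list_det \<phi> r (xs @ remove_nth i ys))"
proof -
  let ?f = "\<lambda>i. (- 1) ^ i * \<phi> r ((xs @ ys) ! i) * list_det \<phi> r (remove_nth i (xs @ ys))"
  have "list_det \<phi> (Suc r) (xs @ ys) =
      (\<Sum>i<length xs. ?f i) + (\<Sum>i<length ys. ?f (length xs + i))"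
    by (simp add: sum_lessThan_add)
  also have "(\<Sum>i<length xs. ?f i) =
      (\<Sum>i<length xs. (- 1) ^ i * \<phi> r (xs ! i) * list_det \<phi> r (remove_nth i xs @ ys))"
    by (intro sum.cong) (auto simp: nth_append remove_nth_append)
  also have "(\<Sum>i<length ys. ?f (length xs + i)) = (- 1) ^ length xs *
      (\<Sum>i<length ys. (- 1) ^ i * \<phi> r (ys ! i) * list_det \<phi> r (xs @ remove_nth i ys))"
    unfolding sum_distrib_left
    by (intro sum.cong) (auto simp: remove_nth_append power_add mult_ac)
  finally show ?thesis .
qed

text \<open>Isolates the term that deletes \<open>v\<close>; every other term keeps \<open>v\<close>
  in the list, which suits induction on \<open>r\<close>. The minus sign comes from the index shift
  past \<open>v\<close>.\<close>

lemma list_det_append_Cons: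
  "list_det \<phi> (Suc r) (xs @ v # ys) =
     (\<Sum>i<length xs. (- 1) ^ i * \<phi> r (xs ! i) * list_det \<phi> r (remove_nth i xs @ v # ys)) +
     (- 1) ^ length xs * (\<phi> r v * list_det \<phi> r (xs @ ys) -
     (\<Sum>i<length ys. (- 1) ^ i * \<phi> r (ys ! i) * list_det \<phi> r (xs @ v # remove_nth i ys)))"
  unfolding list_det_append
  by (simp add: sum.lessThan_Suc_shift sum_negf del: sum.lessThan_Suc)

section \<open>Multilinearity and alternation of \<open>list_det\<close>\<close>

lemma list_det_add:
  assumes "\<And>k u v. \<phi> k (u + v) = \<phi> k u + \<phi> k v"
  shows "list_det \<phi> r (xs @ (u + v) # ys) =
    list_det \<phi> r (xs @ u # ys) + list_det \<phi> r (xs @ v # ys)"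
proof (induction r arbitrary: xs ys)
  case (Suc r)
  show ?case
    unfolding list_det_append_Cons Suc.IH assms by (simp add: algebra_simps sum.distrib)
qed simp

text \<open>Here \<open>c\<close> lies in the ring of values and \<open>f\<close> is any map acting
  as \<open>c\<close> there. This covers field scalars acting through their images in the ring, and
  also replacing an entry by the zero vector.\<close>

lemma list_det_scale:
  assumes "\<And>k v. \<phi> k (f v) = c * \<phi> k v"
  shows "list_det \<phi> r (xs @ f v # ys) = c * list_det \<phi> r (xs @ v # ys)"
proof (induction r arbitrary: xs ys)
  case (Suc r)
  show ?case
    unfolding list_det_append_Cons Suc.IH assms by (simp add: algebra_simps sum_distrib_left)
qed simp

text \<open>Deleting either copy of \<open>v\<close> leaves the same list with opposite signs; in
  all other terms the two copies stay adjacent.\<close>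

lemma list_det_repeat_adjacent: "list_det \<phi> r (xs @ v # v # ys) = 0"
proof (induction r arbitrary: xs ys)
  case (Suc r)
  show ?case
    unfolding list_det_append_Cons by (simp add: Suc.IH sum.lessThan_Suc_shift del: sum.lessThan_Suc)
qed simp

lemma list_det_swap_adjacent:
  assumes add: "\<And>k u v. \<phi> k (u + v) = \<phi> k u + \<phi> k v"
  shows "list_det \<phi> r (xs @ u # v # ys) = - list_det \<phi> r (xs @ v # u # ys)"
proof -
  have "list_det \<phi> r (xs @ (u + v) # (u + v) # ys) =
      list_det \<phi> r (xs @ u # (u + v) # ys) + list_det \<phi> r (xs @ v # (u + v) # ys)"
    by (rule list_det_add[of \<phi>, OF add])
  also have "\<dots> = list_det \<phi> r (xs @ u # v # ys) + list_det \<phi> r (xs @ v # u # ys)"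
    using list_det_add[of \<phi>, OF add, of r "xs @ [u]" u v ys]
      list_det_add[of \<phi>, OF add, of r "xs @ [v]" u v ys]
    by (simp add: list_det_repeat_adjacent)
  finally show ?thesis
    by (simp add: list_det_repeat_adjacent eq_neg_iff_add_eq_0)
qed

text \<open>Adjacent swaps move the first \<open>v\<close> to the right until it meets the
  second.\<close>

lemma list_det_repeat:
  assumes add: "\<And>k u v. \<phi> k (u + v) = \<phi> k u + \<phi> k v"
  shows "list_det \<phi> r (xs @ v # ys @ v # zs) = 0"
proof (induction ys arbitrary: xs)
  case (Cons y ys)
  show ?case
    using list_det_swap_adjacent[of \<phi>, OF add, of r xs v y "ys @ v # zs"] Cons.IH[of "xs @ [y]"] by simp
qed (simp add: list_det_repeat_adjacent)

lemma list_det_repeat_set: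
  assumes add: "\<And>k u v. \<phi> k (u + v) = \<phi> k u + \<phi> k v"
    and "v \<in> set xs \<union> set ys"
  shows "list_det \<phi> r (xs @ v # ys) = 0"
  using assms(2)
proof
  assume "v \<in> set xs"
  then obtain as bs where "xs = as @ v # bs" by (meson split_list)
  then show ?thesis using list_det_repeat[of \<phi>, OF add, of r as v bs ys] by simp
next
  assume "v \<in> set ys"
  then obtain as bs where "ys = as @ v # bs" by (meson split_list)
  then show ?thesis using list_det_repeat[of \<phi>, OF add, of r xs v as bs] by simp
qed

text \<open>Laplace expansion along a block of rows; the summands correspond to the subsets of the
  set of columns.\<close>

lemma list_det_factor:
  "\<exists>\<alpha> \<beta>. \<forall>xs ys. list_det \<phi> r (xs @ ys) = (\<Sum>s<(2::nat) ^ r. \<alpha> s xs * \<beta> s ys)"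
proof (induction r)
  case 0
  show ?case
    by (rule exI[of _ "\<lambda>_ xs. if xs = [] then 1 else 0"],
        rule exI[of _ "\<lambda>_ xs. if xs = [] then 1 else 0"]) simp
next
  case (Suc r)
  then obtain \<alpha> \<beta> where
    IH: "\<And>xs ys. list_det \<phi> r (xs @ ys) = (\<Sum>s<(2::nat) ^ r. \<alpha> s xs * \<beta> s ys)"
    by blast
  define ex where "ex \<gamma> xs = (\<Sum>i<length xs. (- 1) ^ i * \<phi> r (xs ! i) * \<gamma> (remove_nth i xs))"
    for \<gamma> :: "'a list \<Rightarrow> 'b" and xs
  \<comment> \<open>Indices \<open>s < 2 ^ r\<close> stand for the terms that take column
    \<open>r\<close> from \<open>xs\<close>, the shifted indices for those that take it from
    \<open>ys\<close>; the latter have to pass the block \<open>xs\<close>, hence the sign.\<close>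
  define \<alpha>' where "\<alpha>' s xs =
    (if s < 2 ^ r then ex (\<alpha> s) xs else (- 1) ^ length xs * \<alpha> (s - 2 ^ r) xs)" for s :: nat and xs
  define \<beta>' where "\<beta>' s xs =
    (if s < 2 ^ r then \<beta> s xs else ex (\<beta> (s - 2 ^ r)) xs)" for s :: nat and xs
  have "list_det \<phi> (Suc r) (xs @ ys) = (\<Sum>s<2 ^ Suc r. \<alpha>' s xs * \<beta>' s ys)" for xs ys
  proof -
    have split: "(\<Sum>s<2 ^ Suc r. f s) = (\<Sum>s<2 ^ r. f s) + (\<Sum>s<2 ^ r. f (2 ^ r + s))"
      for f :: "nat \<Rightarrow> 'b"
      using sum_lessThan_add[of f "2 ^ r" "2 ^ r"] by (simp add: mult_2)
    have 1: "(\<Sum>i<length xs. (- 1) ^ i * \<phi> r (xs ! i) * list_det \<phi> r (remove_nth i xs @ ys)) =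
      (\<Sum>s<2 ^ r. ex (\<alpha> s) xs * \<beta> s ys)"
      unfolding ex_def IH sum_distrib_left sum_distrib_right
      by (subst sum.swap) (simp add: mult_ac)
    have 2: "(\<Sum>i<length ys. (- 1) ^ i * \<phi> r (ys ! i) * list_det \<phi> r (xs @ remove_nth i ys)) =
      (\<Sum>s<2 ^ r. \<alpha> s xs * ex (\<beta> s) ys)"
      unfolding ex_def IH sum_distrib_left sum_distrib_right
      by (subst sum.swap) (simp add: mult_ac)
    show ?thesis
      unfolding list_det_append 1 2 split
      by (simp add: \<alpha>'_def \<beta>'_def sum_distrib_left mult.assoc)
  qed
  then show ?case by blast
qed

section \<open>A rank bound over integral domains\<close>

text \<open>Gaussian elimination without division, as suits an integral domain: each step clears one
  column by cross-multiplication with a pivot row.\<close>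

lemma exists_linear_relation:
  fixes A :: "'i \<Rightarrow> nat \<Rightarrow> 'r::idom"
  assumes "finite I" "N < card I"
  shows "\<exists>c. (\<exists>i\<in>I. c i \<noteq> 0) \<and> (\<forall>s<N. (\<Sum>i\<in>I. c i * A i s) = 0)"
  using assms
proof (induction N arbitrary: I A)
  case 0
  then obtain i where "i \<in> I" by fastforce
  then show ?case by (intro exI[of _ "\<lambda>_. 1"]) auto
next
  case (Suc N)
  show ?case
  proof (cases "\<forall>i\<in>I. A i N = 0")
    case True
    from Suc.IH[of I A] Suc.prems obtain c where
      "\<exists>i\<in>I. c i \<noteq> 0" "\<forall>s<N. (\<Sum>i\<in>I. c i * A i s) = 0" by auto
    with True show ?thesis by (intro exI[of _ c]) (auto simp: less_Suc_eq)
  next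
    case False
    then obtain p where p: "p \<in> I" "A p N \<noteq> 0" by blast
    define J where "J = I - {p}"
    have J: "finite J" "N < card J" "p \<notin> J" "I = insert p J"
      using Suc.prems p by (auto simp: J_def)
    obtain c where c: "\<exists>i\<in>J. c i \<noteq> 0"
      "\<And>s. s < N \<Longrightarrow> (\<Sum>i\<in>J. c i * (A p N * A i s - A i N * A p s)) = 0"
      using Suc.IH[OF J(1,2), of "\<lambda>i s. A p N * A i s - A i N * A p s"] by auto
    \<comment> \<open>The value at \<open>p\<close> turns a relation among the reduced rows into one
      among the original rows. The relation stays nontrivial because \<open>A p N\<close> is nonzero
      in a domain.\<close>
    define d where "d i = (if i = p then - (\<Sum>j\<in>J. c j * A j N) else c i * A p N)" for i
    have d: "(\<Sum>i\<in>I. d i * A i s) = (\<Sum>i\<in>J. c i * (A p N * A i s - A i N * A p s))" for s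
    proof -
      have "(\<Sum>i\<in>J. d i * A i s) = (\<Sum>i\<in>J. c i * A p N * A i s)"
        using J(3) by (intro sum.cong) (auto simp: d_def)
      then show ?thesis
        using J by (simp add: d_def[of p] sum_distrib_left sum_distrib_right right_diff_distrib
            sum_subtractf mult_ac)
    qed
    have "(\<Sum>i\<in>I. d i * A i s) = 0" if "s < Suc N" for s
      using c(2) that by (cases "s = N") (auto simp: d mult.commute)
    moreover have "\<exists>i\<in>I. d i \<noteq> 0"
      using c(1) p J by (auto simp: d_def)
    ultimately show ?thesis by blast
  qed
qed

text \<open>More than \<open>N\<close> rows of \<open>A\<close> would admit a relation
  \<open>c\<close>. Pairing it with the column of the last index in its support leaves only a
  nonzero diagonal term.\<close>

lemma triangular_factorization_bound:
  fixes A :: "nat \<Rightarrow> nat \<Rightarrow> 'r::idom"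
  assumes fin: "finite I"
    and diag: "\<And>i. i \<in> I \<Longrightarrow> (\<Sum>s<N. A i s * B s i) \<noteq> 0"
    and upper: "\<And>i j. i \<in> I \<Longrightarrow> j \<in> I \<Longrightarrow> i < j \<Longrightarrow> (\<Sum>s<N. A i s * B s j) = 0"
  shows "card I \<le> N"
proof (rule ccontr)
  assume "\<not> card I \<le> N"
  then obtain c where c: "\<exists>i\<in>I. c i \<noteq> 0" "\<And>s. s < N \<Longrightarrow> (\<Sum>i\<in>I. c i * A i s) = 0"
    using exists_linear_relation[OF fin, of N A] by auto
  define j where "j = Max {i \<in> I. c i \<noteq> 0}"
  have j: "j \<in> I" "c j \<noteq> 0"
    using Max_in[of "{i \<in> I. c i \<noteq> 0}"] c(1) fin by (auto simp: j_def)
  have gt: "c i = 0" if "i \<in> I" "i > j" for i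
  proof (rule ccontr)
    assume "c i \<noteq> 0"
    then have "i \<le> j"
      unfolding j_def using fin that by (intro Max_ge) auto
    with that show False by simp
  qed
  have "0 = (\<Sum>s<N. (\<Sum>i\<in>I. c i * A i s) * B s j)"
    using c(2) by simp
  also have "\<dots> = (\<Sum>i\<in>I. c i * (\<Sum>s<N. A i s * B s j))"
    unfolding sum_distrib_left sum_distrib_right by (subst sum.swap) (simp add: mult.assoc)
  also have "\<dots> = (\<Sum>i\<in>I. if i = j then c j * (\<Sum>s<N. A j s * B s j) else 0)"
    using gt upper j by (intro sum.cong refl) (metis linorder_neqE_nat mult_zero_left mult_zero_right)
  also have "\<dots> = c j * (\<Sum>s<N. A j s * B s j)"
    using fin j by simp
  finally show False
    using j diag by simp
qed

section \<open>Generic specialisation of the coordinates\<close>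

text \<open>The substituted \<open>p\<close> has only exponents divisible by \<open>M\<close>, and
  \<open>q\<close> fits into one block of length \<open>M\<close>, so the shifted copies of
  \<open>q\<close> do not overlap.\<close>

lemma coeff_pcompose_monom_mult:
  fixes p q :: "'a::comm_ring_1 poly"
  assumes "degree q < M" "s < M"
  shows "coeff (pcompose p (monom 1 M) * q) (l * M + s) = coeff p l * coeff q s"
proof (induction p arbitrary: l)
  case (pCons a p)
  show ?case
  proof (cases l)
    case 0
    then show ?thesis
      using assms by (simp add: pcompose_pCons distrib_right mult.assoc coeff_monom_mult)
  next
    case (Suc l')
    have "coeff q (Suc l' * M + s) = 0"
      using assms(1) by (intro coeff_eq_0) (simp add: trans_less_add1)
    then show ?thesis
      using Suc pCons.IH[of l']
      by (simp add: pcompose_pCons distrib_right mult.assoc coeff_monom_mult add.assoc)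
  qed
qed simp

text \<open>Column \<open>r\<close> contributes degree at most \<open>(N - 1) * N ^ r\<close>, and
  its minors have degree below \<open>N ^ r\<close>.\<close>

lemma degree_list_det_pcompose:
  fixes P :: "'w \<Rightarrow> 'f::field poly"
  assumes "\<And>w. degree (P w) < N"
  shows "degree (list_det (\<lambda>k w. pcompose (P w) (monom 1 (N ^ k))) r vs) < N ^ r"
proof (induction r arbitrary: vs)
  case (Suc r)
  let ?\<phi> = "\<lambda>k w. pcompose (P w) (monom 1 (N ^ k))"
  have N: "N > 0" using assms[of undefined] by simp
  have "degree ((- 1) ^ i * ?\<phi> r (vs ! i) * list_det ?\<phi> r (remove_nth i vs)) < N ^ Suc r" for i
  proof -
    have "degree ((- 1) ^ i * ?\<phi> r (vs ! i) * list_det ?\<phi> r (remove_nth i vs)) =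
        degree (?\<phi> r (vs ! i) * list_det ?\<phi> r (remove_nth i vs))"
      by (cases "even i") simp_all
    also have "\<dots> \<le> degree (?\<phi> r (vs ! i)) + degree (list_det ?\<phi> r (remove_nth i vs))"
      by (rule degree_mult_le)
    also have "\<dots> < degree (P (vs ! i)) * N ^ r + N ^ r"
      using Suc.IH[of "remove_nth i vs"] by (simp add: degree_pcompose degree_monom_eq)
    also have "\<dots> = Suc (degree (P (vs ! i))) * N ^ r" by simp
    also have "\<dots> \<le> N * N ^ r"
      using assms[of "vs ! i"] by (intro mult_right_mono) auto
    finally show ?thesis by simp
  qed
  then show ?case
    unfolding list_det.simps using N by (intro degree_sum_less) auto
qed simp

section \<open>Linear dependence and vanishing of the determinant\<close>

context vector_space
begin

text \<open>The vectors \<open>v\<close> that make the determinant vanish form a subspace, which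
  contains all the other entries.\<close>

lemma list_det_eq_0_if_mem_span:
  assumes add: "\<And>k u v. \<phi> k (u + v) = \<phi> k u + \<phi> k v"
    and scale: "\<And>k c v. \<phi> k (scale c v) = \<kappa> c * \<phi> k v"
    and "v \<in> span (set xs \<union> set ys)"
  shows "list_det \<phi> r (xs @ v # ys) = 0"
proof -
  have "\<phi> k 0 = 0" for k
    using add[of k 0 0] by simp
  then have "subspace {v. list_det \<phi> r (xs @ v # ys) = 0}"
    using list_det_scale[where \<phi> = \<phi> and f = "\<lambda>_. 0" and c = 0 and v = 0]
    by (auto simp: subspace_def list_det_add[of \<phi>, OF add] list_det_scale[of \<phi>, OF scale])
  moreover have "set xs \<union> set ys \<subseteq> {v. list_det \<phi> r (xs @ v # ys) = 0}"
    using list_det_repeat_set[of \<phi>, OF add] by blast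
  ultimately show ?thesis
    using span_minimal assms(3) by blast
qed

lemma list_det_eq_0_if_dependent:
  assumes add: "\<And>k u v. \<phi> k (u + v) = \<phi> k u + \<phi> k v"
    and scale: "\<And>k c v. \<phi> k (scale c v) = \<kappa> c * \<phi> k v"
    and dep: "\<not> distinct ws \<or> dependent (set ws)"
  shows "list_det \<phi> r ws = 0"
proof (cases "distinct ws")
  case False
  then obtain xs ys zs v where "ws = xs @ [v] @ ys @ [v] @ zs"
    using not_distinct_decomp by blast
  then show ?thesis using list_det_repeat[of \<phi>, OF add] by simp
next
  case True
  with dep obtain v where v: "v \<in> set ws" "v \<in> span (set ws - {v})"
    by (auto simp: dependent_def)
  then obtain xs ys where ws: "ws = xs @ v # ys" by (meson split_list)
  with True have "set ws - {v} = set xs \<union> set ys" by auto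
  with v list_det_eq_0_if_mem_span[of \<phi> \<kappa>, OF add scale] ws show ?thesis by metis
qed

text \<open>Substituting \<open>x ^ N ^ k\<close> plays the role of a fresh variable for every column: the minors
  of the first \<open>r\<close> columns have degree below \<open>N ^ r\<close>, so a vanishing determinant yields, by
  comparing coefficients in base \<open>N ^ r\<close>, a linear relation with scalar coefficients.\<close>

lemma list_det_pcompose_nonzero:
  fixes P :: "'b \<Rightarrow> 'a poly"
  assumes add: "\<And>u v. P (u + v) = P u + P v"
    and scale: "\<And>c v. P (scale c v) = smult c (P v)"
    and inj: "\<And>w. P w = 0 \<Longrightarrow> w = 0"
    and deg: "\<And>w. degree (P w) < N"
    and "distinct ws" "independent (set ws)"
  shows "list_det (\<lambda>k w. pcompose (P w) (monom 1 (N ^ k))) (length ws) ws \<noteq> 0"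
  using assms(5,6)
proof (induction ws rule: rev_induct)
  case (snoc v ws)
  let ?\<phi> = "\<lambda>k w. pcompose (P w) (monom 1 (N ^ k))"
  define r where "r = length ws"
  define vs where "vs = ws @ [v]"
  define Q where "Q i = list_det ?\<phi> r (remove_nth i vs)" for i
  have P_sum: "P (sum f I) = (\<Sum>i\<in>I. P (f i))" for f and I :: "nat set"
    using add[of 0 0] scale[of 0 0] by (induction I rule: infinite_finite_induct) (simp_all add: add)
  \<comment> \<open>This minor omits the last vector, so it is the determinant of \<open>ws\<close>
    and the induction hypothesis applies.\<close>
  have "Q r \<noteq> 0"
    using snoc independent_mono[of "set (ws @ [v])" "set ws"]
    by (auto simp: Q_def r_def vs_def remove_nth_def)
  then obtain s where s: "coeff (Q r) s \<noteq> 0"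
    by (metis leading_coeff_0_iff)
  have degQ: "degree (Q i) < N ^ r" for i
    unfolding Q_def by (rule degree_list_det_pcompose[OF deg])
  have sN: "s < N ^ r"
    using s degQ[of r] le_degree order_le_less_trans by blast
  \<comment> \<open>These are the scalars of the relation: coefficient \<open>l * N ^ r + s\<close>
    of the vanishing determinant is coefficient \<open>l\<close> of \<open>P\<close> at the
    combination of \<open>vs\<close> with weights \<open>d\<close>. By the choice of
    \<open>s\<close>, the weight of \<open>v\<close> is nonzero.\<close>
  define d where "d i = (- 1) ^ i * coeff (Q i) s" for i
  show ?case
  proof
    assume "list_det ?\<phi> (length (ws @ [v])) (ws @ [v]) = 0"
    then have 0: "(\<Sum>i<Suc r. (- 1) ^ i * ?\<phi> r (vs ! i) * Q i) = 0"
      by (simp add: r_def vs_def Q_def)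
    have "coeff (P (\<Sum>i<Suc r. d i *s vs ! i)) l = 0" for l
    proof -
      have "coeff ((- 1) ^ i * ?\<phi> r (vs ! i) * Q i) (l * N ^ r + s) = d i * coeff (P (vs ! i)) l"
        for i
        using coeff_pcompose_monom_mult[OF degQ sN, of "P (vs ! i)" i l]
        by (cases "even i") (simp_all add: d_def)
      then have "(\<Sum>i<Suc r. d i * coeff (P (vs ! i)) l) =
          coeff (\<Sum>i<Suc r. (- 1) ^ i * ?\<phi> r (vs ! i) * Q i) (l * N ^ r + s)"
        unfolding coeff_sum by simp
      then show ?thesis
        unfolding P_sum coeff_sum scale 0 by simp
    qed
    then have "(\<Sum>i<Suc r. d i *s vs ! i) = 0"
      by (intro inj poly_eqI) simp
    moreover have "(\<Sum>i<r. d i *s vs ! i) \<in> span (set ws)"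
      by (intro span_sum span_scale span_base) (auto simp: r_def vs_def nth_append)
    ultimately have "d r *s v \<in> span (set ws)"
      using span_neg[of "\<Sum>i<r. d i *s vs ! i" "set ws"]
      by (simp add: r_def vs_def add_eq_0_iff)
    moreover have "d r \<noteq> 0" using s by (simp add: d_def)
    ultimately have "v \<in> span (set ws)"
      using span_scale[of "d r *s v" "set ws" "inverse (d r)"] by simp
    then show False
      using snoc.prems by (auto simp: dependent_def)
  qed
qed simp

end

section \<open>Orthogonal complements\<close>

context finite_dimensional_vector_space
begin

abbreviation coord :: "'b \<Rightarrow> 'b \<Rightarrow> 'a" where
  "coord \<equiv> representation Basis"

definition coord_form :: "'b \<Rightarrow> 'b \<Rightarrow> 'a" where
  "coord_form u v = (\<Sum>b\<in>Basis. coord u b * coord v b)"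

definition orth :: "'b set \<Rightarrow> 'b set" where
  "orth S = {w. \<forall>s\<in>S. coord_form w s = 0}"

lemma coord_add: "coord (u + v) b = coord u b + coord v b"
  using representation_add[OF independent_Basis, of v u] by (simp add: span_Basis)

lemma coord_scale: "coord (c *s v) b = c * coord v b"
  using representation_scale[OF independent_Basis, of v c] by (simp add: span_Basis)

lemma coord_sum: "coord (sum f I) b = (\<Sum>i\<in>I. coord (f i) b)"
  using representation_sum[OF independent_Basis, of I f] by (simp add: span_Basis)

lemma sum_coord: "(\<Sum>b\<in>Basis. coord v b *s b) = v"
  by (rule sum_representation_eq[OF independent_Basis]) (auto simp: span_Basis finite_Basis)

lemma coord_eqI: "(\<And>b. b \<in> Basis \<Longrightarrow> coord u b = coord v b) \<Longrightarrow> u = v"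
  by (metis (no_types, lifting) sum.cong sum_coord)

lemma coord_basis_combination:
  assumes "b \<in> Basis"
  shows "coord (\<Sum>b'\<in>Basis. f b' *s b') b = f b"
proof -
  have "coord (\<Sum>b'\<in>Basis. f b' *s b') b = (\<Sum>b'\<in>Basis. if b' = b then f b else 0)"
    unfolding coord_sum coord_scale
    by (intro sum.cong refl) (simp add: representation_basis[OF independent_Basis])
  then show ?thesis
    using assms finite_Basis by simp
qed

lemma coord_form_add_right: "coord_form w (u + v) = coord_form w u + coord_form w v"
  by (simp add: coord_form_def coord_add algebra_simps sum.distrib)

lemma coord_form_scale_right: "coord_form w (c *s v) = c * coord_form w v"
  by (simp add: coord_form_def coord_scale algebra_simps sum_distrib_left)

lemma coord_form_commute: "coord_form u v = coord_form v u"
  by (simp add: coord_form_def mult.commute)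

lemma coord_form_zero_right: "coord_form w 0 = 0"
  using coord_form_scale_right[of w 0 0] by simp

lemma coord_form_sum_right: "coord_form w (sum f I) = (\<Sum>i\<in>I. coord_form w (f i))"
  by (induction I rule: infinite_finite_induct)
    (simp_all add: coord_form_add_right coord_form_zero_right)

lemma coord_form_basis_right: "b \<in> Basis \<Longrightarrow> coord_form v b = coord v b"
  by (simp add: coord_form_def representation_basis[OF independent_Basis] finite_Basis
      if_distrib[of "\<lambda>x. _ * x"] cong: if_cong)

lemma subspace_coord_form_null: "subspace {v. coord_form w v = 0}"
  by (simp add: subspace_def coord_form_add_right coord_form_scale_right coord_form_zero_right)

lemma orth_eq: "orth S = {w. \<forall>s\<in>S. coord_form s w = 0}"
  unfolding orth_def by (subst coord_form_commute) (rule refl)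

lemma subspace_orth: "subspace (orth S)"
  by (simp add: subspace_def orth_eq coord_form_add_right coord_form_scale_right
      coord_form_zero_right)

lemma orth_antimono: "S \<subseteq> T \<Longrightarrow> orth T \<subseteq> orth S"
  by (auto simp: orth_def)

lemma orth_span: "orth (span S) = orth S"
proof
  show "orth S \<subseteq> orth (span S)"
  proof
    fix w assume "w \<in> orth S"
    then have "span S \<subseteq> {v. coord_form w v = 0}"
      by (intro span_minimal subspace_coord_form_null) (auto simp: orth_def)
    then show "w \<in> orth (span S)" by (auto simp: orth_def)
  qed
qed (intro orth_antimono span_superset)

lemma subset_orth_orth: "S \<subseteq> orth (orth S)"
  unfolding orth_def[of "orth S"] unfolding orth_eq by blast

text \<open>The form may have isotropic vectors, so \<open>S\<close> and \<open>orth S\<close> need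
  not be complementary. Instead, a basis \<open>B\<close> of the span of \<open>S\<close> is
  extended to a basis \<open>C\<close> of the space; the dual vectors of \<open>C - B\<close> form a
  basis of \<open>orth S\<close>.\<close>

lemma dim_orth: "dim (orth S) + dim S = dimension"
proof -
  obtain B where B: "B \<subseteq> S" "independent B" "S \<subseteq> span B" "card B = dim S"
    using basis_exists[of S] by blast
  obtain C where C: "B \<subseteq> C" "independent C" "span C = UNIV"
    using maximal_independent_subset_extend[of B UNIV] B(2) by (metis subset_UNIV top.extremum_unique)
  have fC: "finite C"
    using C(2) by (rule finiteI_independent)
  let ?rC = "representation C"
  \<comment> \<open>The vector that represents, through the form, the coordinate functional of
    \<open>c\<close> with respect to \<open>C\<close>.\<close>
  define dual where "dual c = (\<Sum>b\<in>Basis. ?rC b c *s b)" for c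
  have sum_rC: "(\<Sum>c\<in>C. ?rC v c *s c) = v" for v
    by (rule sum_representation_eq[OF C(2)]) (auto simp: C fC)
  have coord_dual: "coord (dual c) b = ?rC b c" if "b \<in> Basis" for b c
    using that by (simp add: dual_def coord_basis_combination)
  have form_dual: "coord_form (dual c) v = ?rC v c" for c v
  proof -
    have "?rC v c = ?rC (\<Sum>b\<in>Basis. coord v b *s b) c"
      by (simp add: sum_coord)
    also have "\<dots> = (\<Sum>b\<in>Basis. coord v b * ?rC b c)"
      by (simp add: representation_sum[OF C(2)] representation_scale[OF C(2)] C(3))
    finally show ?thesis
      by (simp add: coord_form_def coord_dual mult.commute)
  qed
  have form_dual_basis: "coord_form (dual c) c' = (if c' = c then 1 else 0)" if "c' \<in> C" for c c'
    using that by (simp add: form_dual representation_basis[OF C(2)])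
  have expand: "(\<Sum>c\<in>C. coord_form v c *s dual c) = v" for v
  proof (rule coord_eqI)
    fix b assume b: "b \<in> Basis"
    have "coord (\<Sum>c\<in>C. coord_form v c *s dual c) b = (\<Sum>c\<in>C. ?rC b c * coord_form v c)"
      using b by (simp add: coord_sum coord_scale coord_dual mult.commute)
    also have "\<dots> = coord_form v (\<Sum>c\<in>C. ?rC b c *s c)"
      by (simp add: coord_form_sum_right coord_form_scale_right)
    also have "\<dots> = coord v b"
      using b by (simp add: sum_rC coord_form_basis_right)
    finally show "coord (\<Sum>c\<in>C. coord_form v c *s dual c) b = coord v b" .
  qed
  have inj: "inj_on dual C"
    by (rule inj_onI) (metis form_dual_basis zero_neq_one)
  have indep: "independent (dual ` C)"
    unfolding dependent_def
  proof safe
    fix c assume c: "c \<in> C" "dual c \<in> span (dual ` C - {dual c})"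
    have "dual ` C - {dual c} \<subseteq> {v. coord_form c v = 0}"
      using c(1) by (auto simp: coord_form_commute[of c] form_dual_basis)
    then have "span (dual ` C - {dual c}) \<subseteq> {v. coord_form c v = 0}"
      by (intro span_minimal subspace_coord_form_null)
    with c show False
      by (auto simp: coord_form_commute[of c] form_dual_basis)
  qed
  have "orth S = span (dual ` (C - B))"
  proof
    show "orth S \<subseteq> span (dual ` (C - B))"
    proof
      fix w assume w: "w \<in> orth S"
      have "(\<Sum>c\<in>C. coord_form w c *s dual c) = (\<Sum>c\<in>C - B. coord_form w c *s dual c)"
        using w B(1) fC by (intro sum.mono_neutral_right) (auto simp: orth_def)
      also have "\<dots> \<in> span (dual ` (C - B))"
        by (intro span_sum span_scale span_base) auto
      finally show "w \<in> span (dual ` (C - B))" by (simp add: expand)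
    qed
    have "dual ` (C - B) \<subseteq> orth B"
      using C(1) by (auto simp: orth_def form_dual_basis)
    also have "\<dots> \<subseteq> orth S"
      using orth_antimono[OF B(3)] by (simp add: orth_span)
    finally show "span (dual ` (C - B)) \<subseteq> orth S"
      by (intro span_minimal subspace_orth)
  qed
  then have "dim (orth S) = card (dual ` (C - B))"
    by (simp add: dim_eq_card_independent independent_mono[OF indep] image_mono)
  also have "\<dots> = card C - card B"
    using inj C(1) fC by (simp add: card_image inj_on_diff card_Diff_subset finite_subset)
  also have "card C = dimension"
    using dim_eq_card[of C UNIV] C by (simp add: dimension_def)
  finally show ?thesis
    using B(4) dim_subset_UNIV[of S] by simp
qed

lemma orth_orth: "subspace S \<Longrightarrow> orth (orth S) = S"
  using subspace_dim_equal[of S "orth (orth S)"] dim_orth[of S] dim_orth[of "orth S"]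
    subset_orth_orth[of S] subspace_orth[of "orth S"]
  by simp

text \<open>Double complements turn the complement of the union into \<open>U \<inter> V\<close>, so
  intersection dimensions become dimensions of spans.\<close>

lemma dim_orth_Un_orth:
  assumes "subspace U" "subspace V"
  shows "dim (orth U \<union> orth V) + dim (U \<inter> V) = dimension"
proof -
  have "orth (orth U \<union> orth V) = orth (orth U) \<inter> orth (orth V)"
    by (auto simp: orth_def)
  then have "orth (orth U \<union> orth V) = U \<inter> V"
    using assms by (simp add: orth_orth)
  then show ?thesis
    using dim_orth[of "orth U \<union> orth V"] by simp
qed

section \<open>Skew spanning pairs\<close>

text \<open>The coordinates of a vector become the coefficients of a polynomial. The bound
  \<open>Suc dimension\<close> stays valid in dimension 0.\<close>

lemma coordinate_polynomial_exists:
  obtains P :: "'b \<Rightarrow> 'a poly"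
  where "\<And>u v. P (u + v) = P u + P v" "\<And>c v. P (c *s v) = smult c (P v)"
    "\<And>w. P w = 0 \<Longrightarrow> w = 0" "\<And>w. degree (P w) < Suc dimension"
proof -
  obtain \<iota> where \<iota>: "bij_betw \<iota> Basis {0..<card Basis}"
    using ex_bij_betw_finite_nat[OF finite_Basis] by blast
  define P where "P w = (\<Sum>b\<in>Basis. monom (coord w b) (\<iota> b))" for w
  have coeff_P: "coeff (P w) (\<iota> b) = coord w b" if "b \<in> Basis" for w b
  proof -
    have "coeff (P w) (\<iota> b) = (\<Sum>b'\<in>Basis. if b' = b then coord w b else 0)"
      unfolding P_def coeff_sum
      using that \<iota> by (intro sum.cong refl) (auto simp: bij_betw_def inj_on_def)
    then show ?thesis using that finite_Basis by simp
  qed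
  show thesis
  proof (rule that[of P])
    show "P (u + v) = P u + P v" for u v
      by (simp add: P_def coord_add add_monom[symmetric] sum.distrib)
    show "P (c *s v) = smult c (P v)" for c v
      by (rule poly_eqI) (auto simp: P_def coord_scale coeff_sum sum_distrib_left intro!: sum.cong)
    show "w = 0" if "P w = 0" for w
      using that coeff_P[of _ w] by (intro coord_eqI) (auto simp: representation_zero)
    show "degree (P w) < Suc dimension" for w
    proof -
      have "degree (monom (coord w b) (\<iota> b)) \<le> dimension" if "b \<in> Basis" for b
      proof -
        have "\<iota> b < dimension"
          using bij_betwE[OF \<iota>] that by (auto simp: dimension_def)
        then show ?thesis
          using degree_monom_le[of "coord w b" "\<iota> b"] by linarith
      qed
      then show ?thesis
        unfolding P_def less_Suc_eq_le by (intro degree_sum_le finite_Basis) auto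
    qed
  qed
qed

lemma skew_spanning_pairs_bound:
  fixes X Y :: "nat \<Rightarrow> 'b set"
  assumes diag: "\<And>i. i \<in> I \<Longrightarrow> r \<le> dim (X i \<union> Y i)"
    and upper: "\<And>i j. i \<in> I \<Longrightarrow> j \<in> I \<Longrightarrow> i < j \<Longrightarrow> dim (X i \<union> Y j) < r"
    and fin: "finite I"
  shows "card I \<le> 2 ^ r"
proof -
  obtain P :: "'b \<Rightarrow> 'a poly" where P:
    "\<And>u v. P (u + v) = P u + P v" "\<And>c v. P (c *s v) = smult c (P v)"
    "\<And>w. P w = 0 \<Longrightarrow> w = 0" "\<And>w. degree (P w) < Suc dimension"
    by (rule coordinate_polynomial_exists) (rule that)
  define \<phi> where "\<phi> k w = pcompose (P w) (monom 1 (Suc dimension ^ k))" for k :: nat and w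
  have add: "\<phi> k (u + v) = \<phi> k u + \<phi> k v" for k u v
    by (simp add: \<phi>_def P pcompose_add)
  have scale: "\<phi> k (c *s v) = [:c:] * \<phi> k v" for k c v
    by (simp add: \<phi>_def P pcompose_smult)
  have "\<exists>xs ys. set xs \<subseteq> X i \<and> set ys \<subseteq> Y i \<and> length (xs @ ys) = r \<and>
      distinct (xs @ ys) \<and> independent (set (xs @ ys))" if "i \<in> I" for i
  proof -
    obtain C where C: "C \<subseteq> X i \<union> Y i" "independent C" "card C = dim (X i \<union> Y i)"
      by (rule basis_exists[of "X i \<union> Y i"])
    then have "r \<le> card C"
      using diag[OF that] by simp
    then obtain D where D: "D \<subseteq> C" "card D = r" "finite D"
      by (rule obtain_subset_with_card_n)
    obtain xs where xs: "set xs = D \<inter> X i" "distinct xs"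
      using finite_distinct_list[of "D \<inter> X i"] D(3) by blast
    obtain ys where ys: "set ys = D - X i" "distinct ys"
      using finite_distinct_list[of "D - X i"] D(3) by blast
    have D_eq: "set (xs @ ys) = D" and dist: "distinct (xs @ ys)"
      using xs ys by auto
    show ?thesis
    proof (intro exI conjI)
      show "length (xs @ ys) = r"
        using distinct_card[OF dist] D_eq D(2) by simp
      show "independent (set (xs @ ys))"
        using D_eq independent_mono[OF C(2) D(1)] by simp
    qed (use xs ys C D dist in auto)
  qed
  then obtain xs ys where xy: "\<And>i. i \<in> I \<Longrightarrow> set (xs i) \<subseteq> X i \<and> set (ys i) \<subseteq> Y i \<and>
      length (xs i @ ys i) = r \<and> distinct (xs i @ ys i) \<and> independent (set (xs i @ ys i))"
    by metis
  obtain \<alpha> \<beta> where \<alpha>\<beta>: "\<And>us vs. list_det \<phi> r (us @ vs) = (\<Sum>s<(2::nat) ^ r. \<alpha> s us * \<beta> s vs)"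
    using list_det_factor[of \<phi> r] by blast
  show ?thesis
  proof (rule triangular_factorization_bound[OF fin])
    show "(\<Sum>s<2 ^ r. \<alpha> s (xs i) * \<beta> s (ys i)) \<noteq> 0" if "i \<in> I" for i
      using list_det_pcompose_nonzero[of P "Suc dimension" "xs i @ ys i", OF P] xy[OF that]
      unfolding \<alpha>\<beta>[symmetric] \<phi>_def by simp
    show "(\<Sum>s<2 ^ r. \<alpha> s (xs i) * \<beta> s (ys j)) = 0" if "i \<in> I" "j \<in> I" "i < j" for i j
    \<comment> \<open>The split of \<open>r\<close> into the two lengths may vary with the index, so
      mixed lists can have the wrong length; then \<open>list_det\<close> is 0 by
      convention.\<close>
    proof (cases "length (xs i @ ys j) = r")
      case True
      have "set (xs i @ ys j) \<subseteq> X i \<union> Y j"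
        using xy[OF that(1)] xy[OF that(2)] by auto
      then have "card (set (xs i @ ys j)) < r" if "independent (set (xs i @ ys j))"
        using independent_card_le_dim[OF _ that] upper[OF \<open>i \<in> I\<close> \<open>j \<in> I\<close> \<open>i < j\<close>]
          order_le_less_trans by blast
      then have "\<not> distinct (xs i @ ys j) \<or> dependent (set (xs i @ ys j))"
        using True distinct_card[of "xs i @ ys j"] by (metis less_irrefl)
      then show ?thesis
        unfolding \<alpha>\<beta>[symmetric] by (rule list_det_eq_0_if_dependent[of \<phi>, OF add scale])
    next
      case False
      then show ?thesis
        unfolding \<alpha>\<beta>[symmetric] by (rule list_det_wrong_length)
    qed
  qed
qed

end

section \<open>Passage from intersections to spans of orthogonal complements\<close>

theorem theorem1p7:
  fixes scale :: "'f::field \<Rightarrow> 'w::ab_group_add \<Rightarrow> 'w"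
    and Basis :: "'w set"
    and U V :: "nat \<Rightarrow> 'w set"
    and m n t :: nat
  assumes "finite_dimensional_vector_space scale Basis"
    and "vector_space.dim scale (UNIV :: 'w set) = n"
    and "\<And>i. i \<in> {1..m} \<Longrightarrow> module.subspace scale (U i)"
    and "\<And>i. i \<in> {1..m} \<Longrightarrow> module.subspace scale (V i)"
    and "t \<le> n"
    and "\<And>i. 1 \<le> i \<Longrightarrow> i \<le> m \<Longrightarrow> vector_space.dim scale (U i \<inter> V i) \<le> t"
    and "\<And>i j. 1 \<le> i \<Longrightarrow> i < j \<Longrightarrow> j \<le> m \<Longrightarrow> vector_space.dim scale (U i \<inter> V j) > t"
  shows "m \<le> 2 ^ (n - t)"
proof -
  interpret finite_dimensional_vector_space scale Basis by fact
  have n: "dimension = n"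
    using assms(2) by (simp add: dimension_def)
  have "card {1..m} \<le> 2 ^ (n - t)"
  proof (rule skew_spanning_pairs_bound)
    \<comment> \<open>Complementation reverses the inequalities: at most \<open>t\<close> becomes at
      least \<open>n - t\<close>, and more than \<open>t\<close> becomes less than
      \<open>n - t\<close>.\<close>
    show "n - t \<le> dim (orth (U i) \<union> orth (V i))" if "i \<in> {1..m}" for i
      using dim_orth_Un_orth[OF assms(3)[OF that] assms(4)[OF that]] assms(6)[of i] that n by simp
    show "dim (orth (U i) \<union> orth (V j)) < n - t" if "i \<in> {1..m}" "j \<in> {1..m}" "i < j" for i j
      using dim_orth_Un_orth[OF assms(3)[OF that(1)] assms(4)[OF that(2)]] assms(7)[of i j] that n
      by simp
  qed simp
  then show ?thesis by simp
qed

end
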